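(* Let $d \ge 1$ and let $\mathcal{F_R} = \{R_1,\dots,R_m,f_1,\dots,f_n\}$ ($m,n>0$) be an R-IFS on $\mathbb{R}^d$. Then $\mathcal{F_R}$ has infinitely many compact invariant sets; that is, there are infinitely many distinct nonempty compact sets $A\subset\mathbb{R}^d$ with $$A = \Big[\bigcup_{i=1}^m R_i(A)\Big]\cup\Big[\bigcup_{j=1}^n f_j(A)\Big].$$
   Context: $\mathbb{R}^d$ carries the Euclidean norm. A map $f$ on a metric space $(X,\rho)$ is a (Banach) contraction if there is $\alpha\in[0,1)$ with $\rho(f(x),f(y))\le\alpha\,\rho(x,y)$ for all $x,y$; it is isometric if $\rho(f(x),f(y))=\rho(x,y)$ for all $x,y$. An R-IFS on $\mathbb{R}^d$ is a function system $\{R_1,\dots,R_m,f_1,\dots,f_n\}$ with $m,n>0$, where each $R_i:\mathbb{R}^d\to\mathbb{R}^d$ is an isometric mapping with $R_i(0)=0$ and each $f_j:\mathbb{R}^d\to\mathbb{R}^d$ is a contraction. An invariant set of a finite system $\mathcal{F}$ of continuous self-maps of $X$ is a nonempty closed set $A\subset X$ with $\bigcup_{f\in\mathcal{F}} f(A)=A$. *)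

theory Defs
  imports "HOL-Analysis.Analysis"
begin

text \<open>\<open>lipschitz_on\<close> includes \<open>0 \<le> \<alpha>\<close>, so the constant ranges over \<open>[0, 1)\<close>.\<close>

definition banach_contraction :: "('a::metric_space \<Rightarrow> 'a) \<Rightarrow> bool"
  where "banach_contraction f \<longleftrightarrow> (\<exists>\<alpha><1. \<alpha>-lipschitz_on UNIV f)"

definition isometric_map :: "('a::metric_space \<Rightarrow> 'a) \<Rightarrow> bool"
  where "isometric_map f \<longleftrightarrow> (\<forall>x y. dist (f x) (f y) = dist x y)"

text \<open>
  The system \<open>{R\<^sub>1, \<dots>, R\<^sub>m, f\<^sub>1, \<dots>, f\<^sub>n}\<close> is given by two families of maps; only their values
  at the indices \<open>{1..m}\<close> and \<open>{1..n}\<close> matter.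
\<close>

definition is_R_IFS ::
  "nat \<Rightarrow> nat \<Rightarrow> (nat \<Rightarrow> real^'d \<Rightarrow> real^'d) \<Rightarrow> (nat \<Rightarrow> real^'d \<Rightarrow> real^'d) \<Rightarrow> bool"
  where "is_R_IFS m n R f \<longleftrightarrow>
    m > 0 \<and> n > 0 \<and>
    (\<forall>i\<in>{1..m}. isometric_map (R i) \<and> R i 0 = 0) \<and>
    (\<forall>j\<in>{1..n}. banach_contraction (f j))"

definition R_IFS_maps ::
  "nat \<Rightarrow> nat \<Rightarrow> (nat \<Rightarrow> real^'d \<Rightarrow> real^'d) \<Rightarrow> (nat \<Rightarrow> real^'d \<Rightarrow> real^'d)
    \<Rightarrow> (real^'d \<Rightarrow> real^'d) set"
  where "R_IFS_maps m n R f = R ` {1..m} \<union> f ` {1..n}"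

text \<open>
  Intended for a finite set \<open>F\<close> of continuous maps, as \<open>R_IFS_maps m n R f\<close> is for an R-IFS.
\<close>

definition invariant_set :: "('a::metric_space \<Rightarrow> 'a) set \<Rightarrow> 'a set \<Rightarrow> bool"
  where "invariant_set F A \<longleftrightarrow> A \<noteq> {} \<and> closed A \<and> (\<Union>g\<in>F. g ` A) = A"

lemma invariant_set_R_IFS_maps:
  "invariant_set (R_IFS_maps m n R f) A \<longleftrightarrow>
    A \<noteq> {} \<and> closed A \<and> A = (\<Union>i\<in>{1..m}. R i ` A) \<union> (\<Union>j\<in>{1..n}. f j ` A)"
  unfolding invariant_set_def R_IFS_maps_def UN_Un image_image
  by (auto simp only: eq_commute[of A])

end

theory Submission
  imports Defs
begin

text \<open>
  Every sufficiently large closed ball around the origin is invariant: each isometry fixing \<open>0\<close> is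
  an orthogonal transformation and so maps it onto
  itself, and each contraction maps it into itself.
\<close>

lemma isometric_map_image_cball:
  fixes R :: "real^'d \<Rightarrow> real^'d"
  assumes "isometric_map R" "R 0 = 0"
  shows "R ` cball 0 r = cball 0 r"
proof -
  have "orthogonal_transformation R"
    using assms by (simp add: orthogonal_transformation_isometry isometric_map_def)
  then show ?thesis
    using assms(2) by (simp add: image_orthogonal_transformation_cball)
qed

text \<open>If \<alpha> < 1 is a Lipschitz constant, points of norm at most r go to points of norm
  at most \<open>norm (f 0) + \<alpha> * r\<close>, which large r absorbs. The
  \<open>eventually\<close> form lets finitely many contractions share one threshold.\<close>

lemma banach_contraction_eventually_image_cball_subset:
  fixes f :: "'a::real_normed_vector \<Rightarrow> 'a"
  assumes "banach_contraction f"
  shows "\<forall>\<^sub>F r in at_top. f ` cball 0 r \<subseteq> cball 0 r"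
proof -
  obtain \<alpha> where \<alpha>: "\<alpha> < 1" "\<alpha>-lipschitz_on UNIV f"
    using assms unfolding banach_contraction_def by blast
  \<comment> \<open>The threshold solves \<open>norm (f 0) + \<alpha> * r = r\<close> for r.\<close>
  have "f ` cball 0 r \<subseteq> cball 0 r" if r: "norm (f 0) / (1 - \<alpha>) \<le> r" for r
  proof clarsimp
    fix x :: 'a
    assume x: "norm x \<le> r"
    have "norm (f x) \<le> norm (f 0) + norm (f x - f 0)"
      using norm_triangle_sub by blast
    also have "norm (f x - f 0) \<le> \<alpha> * norm x"
      using lipschitz_onD[OF \<alpha>(2), of x 0] by (simp add: dist_norm)
    also have "\<alpha> * norm x \<le> \<alpha> * r"
      using x lipschitz_on_nonneg[OF \<alpha>(2)] by (rule mult_left_mono)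
    also have "norm (f 0) + \<alpha> * r \<le> r"
      using r \<alpha>(1) by (simp add: field_simps)
    finally show "norm (f x) \<le> r" by simp
  qed
  then show ?thesis
    unfolding eventually_at_top_linorder by blast
qed

theorem theorem2:
  fixes R f :: "nat \<Rightarrow> real^'d \<Rightarrow> real^'d" and m n :: nat
  assumes "is_R_IFS m n R f"
  shows "infinite {A. compact A \<and> invariant_set (R_IFS_maps m n R f) A}"
proof -
  have m: "{1..m} \<noteq> {}"
    and R: "\<And>i r. i \<in> {1..m} \<Longrightarrow> R i ` cball 0 r = cball 0 r"
    and f: "\<And>j. j \<in> {1..n} \<Longrightarrow> \<forall>\<^sub>F r in at_top. f j ` cball 0 r \<subseteq> cball 0 r"
    using assms unfolding is_R_IFS_def
    by (simp, blast intro!: isometric_map_image_cball,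
        blast intro!: banach_contraction_eventually_image_cball_subset)
  have "\<forall>\<^sub>F r in at_top. \<forall>j\<in>{1..n}. f j ` cball 0 r \<subseteq> cball 0 r"
    using f by (simp add: eventually_ball_finite_distrib)
  then obtain r0 where r0: "\<And>r j. r \<ge> r0 \<Longrightarrow> j \<in> {1..n} \<Longrightarrow> f j ` cball 0 r \<subseteq> cball 0 r"
    unfolding eventually_at_top_linorder by blast
  \<comment> \<open>The bound 0 excludes negative radii, whose balls are empty and so not invariant
    sets.\<close>
  have "invariant_set (R_IFS_maps m n R f) (cball 0 r)" if r: "r \<in> {max 0 r0..}" for r
  proof -
    \<comment> \<open>As m > 0, the isometries alone already cover the ball; the contractions only
      have to stay inside it.\<close>
    have "(\<Union>i\<in>{1..m}. R i ` cball 0 r) = cball 0 r"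
      using m R by simp
    moreover have "(\<Union>j\<in>{1..n}. f j ` cball 0 r) \<subseteq> cball 0 r"
      using r r0 by (intro UN_least) simp
    ultimately show ?thesis
      using r unfolding invariant_set_R_IFS_maps by (auto simp only: closed_cball) auto
  qed
  then have "cball 0 ` {max 0 r0..} \<subseteq> {A. compact A \<and> invariant_set (R_IFS_maps m n R f) A}"
    by auto
  \<comment> \<open>Distinct nonnegative radii give distinct balls because the dimension is at least
    1: an index type such as \<open>'d\<close> is never empty.\<close>
  moreover have "inj_on (cball (0::real^'d)) {max 0 r0..}"
    by (auto simp: inj_on_def cball_eq_cball_iff)
  then have "infinite (cball (0::real^'d) ` {max 0 r0..})"
    by (simp add: finite_image_iff infinite_Ici)
  ultimately show ?thesis
    using finite_subset by blast
qed

end
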